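(* Let $\gamma>1$, $0<\alpha\le\gamma\le\alpha+1$, let $U_-,U_m$ be connected by a 1-shock and $U_m,U_+$ by a 2-rarefaction, with wave strengths satisfying $\varepsilon_2\le C(v_-)\varepsilon_1$, and let $T>0$. Suppose that the initial perturbation is zero, i.e. $$\mathcal E_0=\int_{\mathbb R}\eta\big((\mathfrak v_0,\mathfrak u_0)(x)\,|\,(\bar{\mathfrak v},\bar{\mathfrak u})(0,x)\big)dx=0 .$$ Let $(\mathfrak v_\infty,\mathfrak u_\infty)$ be an inviscid limit on $(0,T)$ of solutions of the Navier-Stokes equations with initial data approximating $(\mathfrak v_0,\mathfrak u_0)$, in the sense described in the context. Then $$\mathfrak u_\infty(t,x)=\bar{\mathfrak u}(t,x),\qquad \mathfrak v_\infty(t,x)=\bar{\mathfrak v}(t,x)\qquad\text{for a.e. }(t,x)\in(0,T)\times\mathbb R .$$ Consequently the composite wave $(\bar{\mathfrak v},\bar{\mathfrak u})$ of shock and rarefaction of the compressible Euler system is unique in the class of inviscid limits of the compressible Navier-Stokes equations.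
   Context: Pressure: $p(v)=v^{-\gamma}$. Navier-Stokes system, $(t,x)\in(0,\infty)\times\mathbb R$: $\partial_t\mathfrak v^\nu-\partial_x\mathfrak u^\nu=0$, $\partial_t\mathfrak u^\nu+\partial_xp(\mathfrak v^\nu)=\nu\,\partial_x\big(\frac{b(\mathfrak v^\nu)}{\mathfrak v^\nu}\partial_x\mathfrak u^\nu\big)$, $b(v)=\gamma v^{-\alpha}$, $\mathfrak v^\nu>0$. Euler system: $\partial_t\mathfrak v-\partial_x\mathfrak u=0$, $\partial_t\mathfrak u+\partial_xp(\mathfrak v)=0$. $\lambda_2(v)=\sqrt{-p'(v)}$. States $U_-=(v_-,u_-)$, $U_m=(v_m,u_m)$, $U_+=(v_+,u_+)$, $v_->0$. 1-shock: $0<v_m<v_-$, $\sigma_1=-\sqrt{\frac{p(v_m)-p(v_-)}{v_--v_m}}$, $-\sigma_1(v_m-v_-)=u_m-u_-$, $-\sigma_1(u_m-u_-)=p(v_-)-p(v_m)$. 2-rarefaction: $0<v_+\le v_m$, $u_+=u_m-\int_{v_m}^{v_+}\lambda_2(s)ds$. Strengths $\varepsilon_1=|p(v_-)-p(v_m)|$, $\varepsilon_2=|p(v_m)-p(v_+)|$ ($\varepsilon_2=0$ allowed); $C(v_-)$ is a positive constant depending on $v_-$. Inviscid waves: $(\mathfrak v^s,\mathfrak u^s)(t,x)$ equals $U_-$ for $x<\sigma_1t$ and $U_m$ for $x>\sigma_1t$. The rarefaction is given by $\lambda_2(\mathfrak v^r(x/t))=w^r(x/t)$, $\mathfrak u^r=u_m-\int_{v_m}^{\mathfrak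 v^r}\lambda_2(s)ds$, where $w^r=\lambda_2(v_m)$ if $x\le\lambda_2(v_m)t$, $w^r=x/t$ if $\lambda_2(v_m)t<x<\lambda_2(v_+)t$, $w^r=\lambda_2(v_+)$ if $x\ge\lambda_2(v_+)t$. The composite wave (Riemann solution) is $\bar{\mathfrak v}=\mathfrak v^s+\mathfrak v^r-v_m$, $\bar{\mathfrak u}=\mathfrak u^s+\mathfrak u^r-u_m$. Relative quantities: $Q(v)=\frac{v^{1-\gamma}}{\gamma-1}$, $Q(v_1|v_2)=Q(v_1)-Q(v_2)-Q'(v_2)(v_1-v_2)$, $\eta((v_1,u_1)|(v_2,u_2))=\frac12|u_1-u_2|^2+Q(v_1|v_2)$. Approximate waves: $(\tilde v^s,\tilde u^s)(\xi)$ solves $-\sigma_1(\tilde v^s)'-(\tilde u^s)'=0$, $-\sigma_1(\tilde u^s)'+(p(\tilde v^s))'=\big(\frac{b(\tilde v^s)}{\tilde v^s}(\tilde u^s)'\big)'$ and connects $U_-$ at $-\infty$ to $U_m$ at $+\infty$. With $a=a(\nu)>0$, $a(\nu)\to0$, $\nu/a(\nu)\to0$ as $\nu\to0+$, $w_a$ solves $w_t+ww_x=0$, $w(0,x)=\frac12(\lambda_2(v_m)+\lambda_2(v_+))+\frac12(\lambda_2(v_+)-\lambda_2(v_m))\tanh(x/a)$, and $\lambda_2(\tilde v^r)=w_a$, $\tilde u^r=u_m-\int_{v_m}^{\tilde v^r}\lambda_2(s)ds$. Put $\tilde{\mathfrak v}_0^\nu(x)=\tilde v^s(x/\nu)+\tilde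 v^r(0,x)-v_m$, $\tilde{\mathfrak u}_0^\nu(x)=\tilde u^s(x/\nu)+\tilde u^r(0,x)-u_m$. Inviscid limit: $(\mathfrak v_\infty,\mathfrak u_\infty)$ arises as follows. There are smooth $(\mathfrak v_0^\nu,\mathfrak u_0^\nu)$ with $\mathfrak v_0^\nu>0$, $\mathfrak v_0^\nu\to\mathfrak v_0$ in $L^1_{\rm loc}(\mathbb R)$, $(\mathfrak v_0^\nu,\mathfrak u_0^\nu)\to(\mathfrak v_0,\mathfrak u_0)$ a.e., and $\int_{\mathbb R}\{Q(\mathfrak v_0^\nu|\tilde{\mathfrak v}_0^\nu)+\frac12[\mathfrak u_0^\nu+\nu\frac\gamma\alpha(p(\mathfrak v_0^\nu)^{\alpha/\gamma})_x-\tilde{\mathfrak u}_0^\nu-\nu\frac\gamma\alpha(p(\tilde{\mathfrak v}_0^\nu)^{\alpha/\gamma})_x]^2\}dx\to\mathcal E_0$; smooth solutions $(\mathfrak v^\nu,\mathfrak u^\nu)$ of the Navier-Stokes system with these data converge weakly, $\mathfrak v^\nu\rightharpoonup\mathfrak v_\infty$, $\mathfrak u^\nu\rightharpoonup\mathfrak u_\infty$ in the space $\mathcal M_{\rm loc}((0,T)\times\mathbb R)$ of locally bounded Radon measures as $\nu\to0+$, with $\mathfrak v_\infty\in L^\infty(0,T;L^\infty(\mathbb R)+\mathcal M(\mathbb R))$ ($\mathcal M(\mathbb R)$ the Radon measures on $\mathbb R$), $\mathfrak u_\infty\in L^\infty(0,T;L^2_{\rm loc}(\mathbb R))$; and, writing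 $\mathfrak v_\infty=\mathfrak v_a+\mathfrak v_s$ with $d\mathfrak v_a=\mathfrak m_a\,dtdx$ and $\mathfrak v_s$ singular, there are $X_\infty\in BV(0,T)$ and a constant $C(T)>0$ depending only on $T$ such that for a.e. $t\in(0,T)$: $\int_{\mathbb R}\frac12|\mathfrak u_\infty-\bar{\mathfrak u}|^2dx+\int_{\mathbb R}Q(\mathfrak m_a|\bar{\mathfrak v})dx+\int_{\mathbb R}|Q'(\overline V)|\mathfrak v_s(t,dx)\le C(T)(\mathcal E_0+\mathcal E_0^{1/3})$. Here $\overline V=v_-$ on $\overline\Omega$, $\overline V=\mathfrak v^r$ on $(\overline\Omega)^c$, $\Omega=\{(t,x)\in(0,T)\times\mathbb R:x<\sigma_1t+X_\infty(t)\}$, $\overline\Omega$ is its closure, and complements are taken in $(0,T)\times\mathbb R$. *)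

theory Defs
  imports "HOL-Analysis.Analysis"
begin

section \<open>Constitutive laws and relative quantities\<close>

definition pres :: "real \<Rightarrow> real \<Rightarrow> real" where
  "pres \<gamma> v = v powr (- \<gamma>)"

definition visc :: "real \<Rightarrow> real \<Rightarrow> real \<Rightarrow> real" where
  "visc \<gamma> \<alpha> v = \<gamma> * v powr (- \<alpha>)"

definition lambda2 :: "real \<Rightarrow> real \<Rightarrow> real" where
  "lambda2 \<gamma> v = sqrt (- deriv (pres \<gamma>) v)"

definition Qpot :: "real \<Rightarrow> real \<Rightarrow> real" where
  "Qpot \<gamma> v = v powr (1 - \<gamma>) / (\<gamma> - 1)"

text \<open>The relative potential \<open>Q(v1|v2)\<close>, for \<open>v2 > 0\<close>. It is non-negative by convexity, so it takes
  values in \<^typ>\<open>ennreal\<close> and its integrals may diverge. Since \<open>Q(v) \<rightarrow> \<infinity>\<close> as \<open>v \<rightarrow> 0+\<close>, its value is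
  \<open>\<infinity>\<close> for \<open>v1 \<le> 0\<close>; the formula itself must not be used there, because \<open>0 powr a = 0\<close>.\<close>

definition Qrel :: "real \<Rightarrow> real \<Rightarrow> real \<Rightarrow> ennreal" where
  "Qrel \<gamma> v1 v2 =
     (if 0 < v1 then ennreal (Qpot \<gamma> v1 - Qpot \<gamma> v2 - deriv (Qpot \<gamma>) v2 * (v1 - v2)) else \<infinity>)"

definition rel_entropy :: "real \<Rightarrow> real \<times> real \<Rightarrow> real \<times> real \<Rightarrow> ennreal" where
  "rel_entropy \<gamma> U1 U2 = ennreal (\<bar>snd U1 - snd U2\<bar>\<^sup>2 / 2) + Qrel \<gamma> (fst U1) (fst U2)"


section \<open>Elementary waves and the Riemann solution\<close>

definition sigma1 :: "real \<Rightarrow> real \<Rightarrow> real \<Rightarrow> real" where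
  "sigma1 \<gamma> vl vm = - sqrt ((pres \<gamma> vm - pres \<gamma> vl) / (vl - vm))"

definition one_shock :: "real \<Rightarrow> real \<Rightarrow> real \<Rightarrow> real \<Rightarrow> real \<Rightarrow> bool" where
  "one_shock \<gamma> vl ul vm um \<longleftrightarrow>
     0 < vm \<and> vm < vl \<and>
     - sigma1 \<gamma> vl vm * (vm - vl) = um - ul \<and>
     - sigma1 \<gamma> vl vm * (um - ul) = pres \<gamma> vl - pres \<gamma> vm"

text \<open>The velocity on the 2-rarefaction curve through \<open>(vm, um)\<close>; the integral is oriented, so it is
  non-positive for \<open>v \<le> vm\<close>.\<close>

definition rarefaction_u :: "real \<Rightarrow> real \<Rightarrow> real \<Rightarrow> real \<Rightarrow> real" where
  "rarefaction_u \<gamma> vm um v = um - (LBINT s=ereal vm..ereal v. lambda2 \<gamma> s)"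

definition two_rarefaction :: "real \<Rightarrow> real \<Rightarrow> real \<Rightarrow> real \<Rightarrow> real \<Rightarrow> bool" where
  "two_rarefaction \<gamma> vm um vp up \<longleftrightarrow> 0 < vp \<and> vp \<le> vm \<and> up = rarefaction_u \<gamma> vm um vp"

text \<open>The solution \<open>v > 0\<close> of \<open>\<lambda>\<^sub>2(v) = w\<close>, unique because \<open>\<lambda>\<^sub>2\<close> is strictly decreasing there.\<close>

definition lambda2_inv :: "real \<Rightarrow> real \<Rightarrow> real" where
  "lambda2_inv \<gamma> w = inv_into {0<..} (lambda2 \<gamma>) w"

definition shock_wave :: "real \<Rightarrow> real \<Rightarrow> real \<Rightarrow> real \<Rightarrow> real \<Rightarrow> real" where
  "shock_wave \<sigma> left right t x = (if x < \<sigma> * t then left else right)"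

text \<open>The rarefaction as a function of \<open>(t, x)\<close>. At \<open>t = 0\<close> the case distinction gives the jump
  from \<open>\<lambda>\<^sub>2(vm)\<close> to \<open>\<lambda>\<^sub>2(vp)\<close>, so the waves below have the Riemann data as their values at \<open>t = 0\<close>.\<close>

definition rarefaction_w :: "real \<Rightarrow> real \<Rightarrow> real \<Rightarrow> real \<Rightarrow> real \<Rightarrow> real" where
  "rarefaction_w \<gamma> vm vp t x =
     (if x \<le> lambda2 \<gamma> vm * t then lambda2 \<gamma> vm
      else if x < lambda2 \<gamma> vp * t then x / t
      else lambda2 \<gamma> vp)"

definition rarefaction_wave_v :: "real \<Rightarrow> real \<Rightarrow> real \<Rightarrow> real \<Rightarrow> real \<Rightarrow> real" where
  "rarefaction_wave_v \<gamma> vm vp t x = lambda2_inv \<gamma> (rarefaction_w \<gamma> vm vp t x)"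

definition rarefaction_wave_u :: "real \<Rightarrow> real \<Rightarrow> real \<Rightarrow> real \<Rightarrow> real \<Rightarrow> real \<Rightarrow> real" where
  "rarefaction_wave_u \<gamma> vm um vp t x = rarefaction_u \<gamma> vm um (rarefaction_wave_v \<gamma> vm vp t x)"

definition composite_v :: "real \<Rightarrow> real \<Rightarrow> real \<Rightarrow> real \<Rightarrow> real \<Rightarrow> real \<Rightarrow> real" where
  "composite_v \<gamma> vl vm vp t x =
     shock_wave (sigma1 \<gamma> vl vm) vl vm t x + rarefaction_wave_v \<gamma> vm vp t x - vm"

definition composite_u :: "real \<Rightarrow> real \<Rightarrow> real \<Rightarrow> real \<Rightarrow> real \<Rightarrow> real \<Rightarrow> real \<Rightarrow> real \<Rightarrow> real" where
  "composite_u \<gamma> vl ul vm um vp t x =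
     shock_wave (sigma1 \<gamma> vl vm) ul um t x + rarefaction_wave_u \<gamma> vm um vp t x - um"

definition initial_energy ::
    "real \<Rightarrow> real \<Rightarrow> real \<Rightarrow> real \<Rightarrow> real \<Rightarrow> real \<Rightarrow> (real \<Rightarrow> real) \<Rightarrow> (real \<Rightarrow> real) \<Rightarrow> ennreal" where
  "initial_energy \<gamma> vl ul vm um vp v0 u0 =
     (\<integral>\<^sup>+x. rel_entropy \<gamma> (v0 x, u0 x)
        (composite_v \<gamma> vl vm vp 0 x, composite_u \<gamma> vl ul vm um vp 0 x) \<partial>lborel)"


section \<open>Smooth solutions of the Navier--Stokes system\<close>

text \<open>Only used for open \<open>S\<close>.\<close>

primrec Ck_on :: "nat \<Rightarrow> 'a::euclidean_space set \<Rightarrow> ('a \<Rightarrow> real) \<Rightarrow> bool" where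
  "Ck_on 0 S f \<longleftrightarrow> continuous_on S f"
| "Ck_on (Suc k) S f \<longleftrightarrow>
     (\<forall>p\<in>S. f differentiable (at p)) \<and> (\<forall>h. Ck_on k S (\<lambda>p. frechet_derivative f (at p) h))"

definition smooth_on :: "'a::euclidean_space set \<Rightarrow> ('a \<Rightarrow> real) \<Rightarrow> bool" where
  "smooth_on S f \<longleftrightarrow> (\<forall>k. Ck_on k S f)"

text \<open>Functions of time and space are curried, time first. Solutions are smooth for \<open>t > 0\<close> and
  attain their data continuously.\<close>

definition smooth_evolution :: "(real \<Rightarrow> real \<Rightarrow> real) \<Rightarrow> (real \<Rightarrow> real) \<Rightarrow> bool" where
  "smooth_evolution f f0 \<longleftrightarrow>
     smooth_on ({0<..} \<times> UNIV) (case_prod f) \<and>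
     continuous_on ({0..} \<times> UNIV) (case_prod f) \<and>
     (\<forall>x. f 0 x = f0 x)"

definition NS_solution ::
    "real \<Rightarrow> real \<Rightarrow> real \<Rightarrow> (real \<Rightarrow> real) \<Rightarrow> (real \<Rightarrow> real) \<Rightarrow>
     (real \<Rightarrow> real \<Rightarrow> real) \<Rightarrow> (real \<Rightarrow> real \<Rightarrow> real) \<Rightarrow> bool" where
  "NS_solution \<gamma> \<alpha> \<nu> v0 u0 v u \<longleftrightarrow>
     smooth_evolution v v0 \<and> smooth_evolution u u0 \<and>
     (\<forall>t>0. \<forall>x. 0 < v t x \<and>
        deriv (\<lambda>s. v s x) t - deriv (\<lambda>y. u t y) x = 0 \<and>
        deriv (\<lambda>s. u s x) t + deriv (\<lambda>y. pres \<gamma> (v t y)) x =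
          \<nu> * deriv (\<lambda>y. visc \<gamma> \<alpha> (v t y) / v t y * deriv (\<lambda>z. u t z) y) x)"


section \<open>Approximate waves\<close>

definition viscous_shock ::
    "real \<Rightarrow> real \<Rightarrow> real \<Rightarrow> real \<Rightarrow> real \<Rightarrow> real \<Rightarrow> (real \<Rightarrow> real) \<Rightarrow> (real \<Rightarrow> real) \<Rightarrow> bool" where
  "viscous_shock \<gamma> \<alpha> vl ul vm um vs us \<longleftrightarrow>
     smooth_on UNIV vs \<and> smooth_on UNIV us \<and>
     (\<forall>\<xi>. 0 < vs \<xi> \<and>
        - sigma1 \<gamma> vl vm * deriv vs \<xi> - deriv us \<xi> = 0 \<and>
        - sigma1 \<gamma> vl vm * deriv us \<xi> + deriv (\<lambda>y. pres \<gamma> (vs y)) \<xi> =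
          deriv (\<lambda>y. visc \<gamma> \<alpha> (vs y) / vs y * deriv us y) \<xi>) \<and>
     (vs \<longlongrightarrow> vl) at_bot \<and> (us \<longlongrightarrow> ul) at_bot \<and>
     (vs \<longlongrightarrow> vm) at_top \<and> (us \<longlongrightarrow> um) at_top"

definition burgers_wave :: "real \<Rightarrow> real \<Rightarrow> real \<Rightarrow> real \<Rightarrow> (real \<Rightarrow> real \<Rightarrow> real) \<Rightarrow> bool" where
  "burgers_wave \<gamma> vm vp a w \<longleftrightarrow>
     smooth_evolution w
       (\<lambda>x. (lambda2 \<gamma> vm + lambda2 \<gamma> vp) / 2 + (lambda2 \<gamma> vp - lambda2 \<gamma> vm) / 2 * tanh (x / a)) \<and>
     (\<forall>t>0. \<forall>x. deriv (\<lambda>s. w s x) t + w t x * deriv (\<lambda>y. w t y) x = 0)"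

definition approx_v0 ::
    "real \<Rightarrow> real \<Rightarrow> real \<Rightarrow> (real \<Rightarrow> real) \<Rightarrow> (real \<Rightarrow> real \<Rightarrow> real) \<Rightarrow> real \<Rightarrow> real" where
  "approx_v0 \<gamma> vm \<nu> vs w x = vs (x / \<nu>) + lambda2_inv \<gamma> (w 0 x) - vm"

definition approx_u0 ::
    "real \<Rightarrow> real \<Rightarrow> real \<Rightarrow> real \<Rightarrow> (real \<Rightarrow> real) \<Rightarrow> (real \<Rightarrow> real \<Rightarrow> real) \<Rightarrow> real \<Rightarrow> real" where
  "approx_u0 \<gamma> vm um \<nu> us w x =
     us (x / \<nu>) + rarefaction_u \<gamma> vm um (lambda2_inv \<gamma> (w 0 x)) - um"

definition effective_velocity ::
    "real \<Rightarrow> real \<Rightarrow> real \<Rightarrow> (real \<Rightarrow> real) \<Rightarrow> (real \<Rightarrow> real) \<Rightarrow> real \<Rightarrow> real" where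
  "effective_velocity \<gamma> \<alpha> \<nu> v u x =
     u x + \<nu> * (\<gamma> / \<alpha>) * deriv (\<lambda>y. pres \<gamma> (v y) powr (\<alpha> / \<gamma>)) x"

definition approx_energy ::
    "real \<Rightarrow> real \<Rightarrow> real \<Rightarrow> (real \<Rightarrow> real) \<Rightarrow> (real \<Rightarrow> real) \<Rightarrow> (real \<Rightarrow> real) \<Rightarrow> (real \<Rightarrow> real) \<Rightarrow> ennreal"
  where
  "approx_energy \<gamma> \<alpha> \<nu> v u v' u' =
     (\<integral>\<^sup>+x. Qrel \<gamma> (v x) (v' x) +
        ennreal ((effective_velocity \<gamma> \<alpha> \<nu> v u x - effective_velocity \<gamma> \<alpha> \<nu> v' u' x)\<^sup>2 / 2) \<partial>lborel)"


section \<open>Measures on the space-time strip\<close>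

abbreviation strip :: "real \<Rightarrow> (real \<times> real) set" where
  "strip T \<equiv> {0<..<T} \<times> UNIV"

abbreviation lborel_strip :: "real \<Rightarrow> (real \<times> real) measure" where
  "lborel_strip T \<equiv> restrict_space lborel (strip T)"

text \<open>Non-negative Radon measures. The limit of the specific volumes is a weak limit of positive
  functions, so signed measures are not needed for it.\<close>

definition radon_on_strip :: "real \<Rightarrow> (real \<times> real) measure \<Rightarrow> bool" where
  "radon_on_strip T V \<longleftrightarrow>
     sets V = sets (lborel_strip T) \<and> (\<forall>K. compact K \<and> K \<subseteq> strip T \<longrightarrow> emeasure V K < \<infinity>)"

definition test_fun :: "real \<Rightarrow> (real \<times> real \<Rightarrow> real) \<Rightarrow> bool" where
  "test_fun T \<phi> \<longleftrightarrow>
     continuous_on UNIV \<phi> \<and> (\<exists>K. compact K \<and> K \<subseteq> strip T \<and> (\<forall>p. p \<notin> K \<longrightarrow> \<phi> p = 0))"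

text \<open>Families of finite measures on the line; \<open>slice_measure T \<kappa>\<close> is the measure
  \<open>\<kappa>(t, dx) dt\<close> on the strip.\<close>

definition time_kernel :: "real \<Rightarrow> (real \<Rightarrow> real measure) \<Rightarrow> bool" where
  "time_kernel T \<kappa> \<longleftrightarrow>
     (\<forall>t\<in>{0<..<T}. sets (\<kappa> t) = sets borel \<and> finite_measure (\<kappa> t)) \<and>
     (\<forall>B\<in>sets borel. (\<lambda>t. emeasure (\<kappa> t) B) \<in> borel_measurable (restrict_space lborel {0<..<T}))"

definition slice_measure :: "real \<Rightarrow> (real \<Rightarrow> real measure) \<Rightarrow> (real \<times> real) set \<Rightarrow> ennreal" where
  "slice_measure T \<kappa> A = (\<integral>\<^sup>+t\<in>{0<..<T}. emeasure (\<kappa> t) {x. (t, x) \<in> A} \<partial>lborel)"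

text \<open>\<open>V = f dt dx + \<kappa>(t, dx) dt\<close>.\<close>

definition splits_as ::
    "real \<Rightarrow> (real \<times> real) measure \<Rightarrow> (real \<Rightarrow> real \<Rightarrow> real) \<Rightarrow> (real \<Rightarrow> real measure) \<Rightarrow> bool" where
  "splits_as T V f \<kappa> \<longleftrightarrow>
     case_prod f \<in> borel_measurable (lborel_strip T) \<and> (\<forall>t\<in>{0<..<T}. \<forall>x. 0 \<le> f t x) \<and>
     time_kernel T \<kappa> \<and>
     (\<forall>A\<in>sets (lborel_strip T).
        emeasure V A = (\<integral>\<^sup>+(t, x)\<in>A. ennreal (f t x) \<partial>lborel_strip T) + slice_measure T \<kappa> A)"

text \<open>Membership in \<open>L\<^sup>\<infinity>(0,T; L\<^sup>\<infinity>(\<real>) + \<M>(\<real>))\<close>. For non-negative \<open>V\<close> both summands can be taken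
  non-negative: if \<open>V(t,\<cdot>) = f dx + \<mu>\<close> with signed \<open>f\<close> and \<open>\<mu>\<close>, then the part of the density of
  \<open>V(t,\<cdot>)\<close> exceeding \<open>|f|\<close>, together with the singular part, is dominated by \<open>|\<mu>|\<close>.\<close>

definition in_Linf_Linf_plus_measures :: "real \<Rightarrow> (real \<times> real) measure \<Rightarrow> bool" where
  "in_Linf_Linf_plus_measures T V \<longleftrightarrow>
     (\<exists>f \<kappa> M. splits_as T V f \<kappa> \<and>
        (\<forall>t\<in>{0<..<T}. (\<forall>x. f t x \<le> M) \<and> emeasure (\<kappa> t) UNIV \<le> ennreal M))"

definition in_Linf_L2loc :: "real \<Rightarrow> (real \<Rightarrow> real \<Rightarrow> real) \<Rightarrow> bool" where
  "in_Linf_L2loc T u \<longleftrightarrow>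
     case_prod u \<in> borel_measurable (lborel_strip T) \<and>
     (\<forall>K. compact K \<longrightarrow>
        (\<exists>M. AE t in lborel. t \<in> {0<..<T} \<longrightarrow> (\<integral>\<^sup>+x\<in>K. ennreal (\<bar>u t x\<bar>\<^sup>2) \<partial>lborel) \<le> ennreal M))"

text \<open>The Lebesgue decomposition of \<open>V\<close>, the singular part being given by its time slices.\<close>

definition lebesgue_decomposition ::
    "real \<Rightarrow> (real \<times> real) measure \<Rightarrow> (real \<Rightarrow> real \<Rightarrow> real) \<Rightarrow> (real \<Rightarrow> real measure) \<Rightarrow> bool" where
  "lebesgue_decomposition T V ma vsing \<longleftrightarrow>
     splits_as T V ma vsing \<and>
     (\<exists>N\<in>null_sets (lborel_strip T). slice_measure T vsing (strip T - N) = 0)"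

text \<open>Finite pointwise variation, i.e. a good representative of a \<open>BV\<close> function is chosen. This
  matters, as the closure of \<open>Omega\<close> below depends on the representative.\<close>

definition bounded_variation_on :: "real set \<Rightarrow> (real \<Rightarrow> real) \<Rightarrow> bool" where
  "bounded_variation_on I X \<longleftrightarrow>
     (\<exists>M. \<forall>(n::nat) \<tau>. mono_on {..n} \<tau> \<and> \<tau> ` {..n} \<subseteq> I \<longrightarrow>
        (\<Sum>i<n. \<bar>X (\<tau> (Suc i)) - X (\<tau> i)\<bar>) \<le> M)"


section \<open>Inviscid limits\<close>

definition Omega :: "real \<Rightarrow> real \<Rightarrow> (real \<Rightarrow> real) \<Rightarrow> (real \<times> real) set" where
  "Omega T \<sigma> X = {(t, x). 0 < t \<and> t < T \<and> x < \<sigma> * t + X t}"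

text \<open>Only evaluated at times in \<open>(0,T)\<close>, where the closure in the plane and the closure in the
  strip coincide.\<close>

definition Vbar ::
    "real \<Rightarrow> real \<Rightarrow> real \<Rightarrow> real \<Rightarrow> real \<Rightarrow> (real \<Rightarrow> real) \<Rightarrow> real \<Rightarrow> real \<Rightarrow> real" where
  "Vbar T \<gamma> vl vm vp X t x =
     (if (t, x) \<in> closure (Omega T (sigma1 \<gamma> vl vm) X) then vl else rarefaction_wave_v \<gamma> vm vp t x)"

definition stability_estimate ::
    "real \<Rightarrow> real \<Rightarrow> real \<Rightarrow> real \<Rightarrow> real \<Rightarrow> real \<Rightarrow> real \<Rightarrow> real \<Rightarrow> real \<Rightarrow>
     (real \<Rightarrow> real \<Rightarrow> real) \<Rightarrow> (real \<Rightarrow> real \<Rightarrow> real) \<Rightarrow> (real \<Rightarrow> real measure) \<Rightarrow> (real \<Rightarrow> real) \<Rightarrow> bool"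
  where
  "stability_estimate T \<gamma> vl ul vm um vp C E u ma vsing X \<longleftrightarrow>
     (AE t in lborel. t \<in> {0<..<T} \<longrightarrow>
        (\<integral>\<^sup>+x. ennreal (\<bar>u t x - composite_u \<gamma> vl ul vm um vp t x\<bar>\<^sup>2 / 2) \<partial>lborel) +
        (\<integral>\<^sup>+x. Qrel \<gamma> (ma t x) (composite_v \<gamma> vl vm vp t x) \<partial>lborel) +
        (\<integral>\<^sup>+x. ennreal \<bar>deriv (Qpot \<gamma>) (Vbar T \<gamma> vl vm vp X t x)\<bar> \<partial>vsing t)
        \<le> ennreal (C * (E + E powr (1 / 3))))"

text \<open>\<open>(V, u)\<close> is an inviscid limit on \<open>(0,T)\<close> of Navier--Stokes solutions with data approximating
  \<open>(v0, u0)\<close>. The function \<open>K\<close> is the constant \<open>C(T)\<close> of the stability estimate. The viscous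
  shock profile is only determined up to translation; any profile is admitted, as is any scaling
  \<open>a\<close>.\<close>

definition inviscid_limit ::
    "real \<Rightarrow> real \<Rightarrow> real \<Rightarrow> real \<Rightarrow> real \<Rightarrow> real \<Rightarrow> real \<Rightarrow> (real \<Rightarrow> real) \<Rightarrow> real \<Rightarrow>
     (real \<Rightarrow> real) \<Rightarrow> (real \<Rightarrow> real) \<Rightarrow> (real \<times> real) measure \<Rightarrow> (real \<Rightarrow> real \<Rightarrow> real) \<Rightarrow> bool" where
  "inviscid_limit \<gamma> \<alpha> vl ul vm um vp K T v0 u0 V u \<longleftrightarrow>
     v0 \<in> borel_measurable borel \<and> u0 \<in> borel_measurable borel \<and>
     initial_energy \<gamma> vl ul vm um vp v0 u0 < \<infinity> \<and>
     radon_on_strip T V \<and> in_Linf_Linf_plus_measures T V \<and> in_Linf_L2loc T u \<and>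
     (\<exists>a vs us w v0n u0n vn un.
        (\<forall>\<nu>>0. 0 < a \<nu>) \<and> (a \<longlongrightarrow> 0) (at_right 0) \<and> ((\<lambda>\<nu>. \<nu> / a \<nu>) \<longlongrightarrow> 0) (at_right 0) \<and>
        viscous_shock \<gamma> \<alpha> vl ul vm um vs us \<and>
        (\<forall>\<nu>>0. burgers_wave \<gamma> vm vp (a \<nu>) (w \<nu>)) \<and>
        (\<forall>\<nu>>0. smooth_on UNIV (v0n \<nu>) \<and> smooth_on UNIV (u0n \<nu>) \<and> (\<forall>x. 0 < v0n \<nu> x)) \<and>
        (\<forall>K. compact K \<longrightarrow>
           ((\<lambda>\<nu>. \<integral>\<^sup>+x\<in>K. ennreal \<bar>v0n \<nu> x - v0 x\<bar> \<partial>lborel) \<longlongrightarrow> 0) (at_right 0)) \<and>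
        (AE x in lborel. ((\<lambda>\<nu>. v0n \<nu> x) \<longlongrightarrow> v0 x) (at_right 0) \<and>
                         ((\<lambda>\<nu>. u0n \<nu> x) \<longlongrightarrow> u0 x) (at_right 0)) \<and>
        ((\<lambda>\<nu>. approx_energy \<gamma> \<alpha> \<nu> (v0n \<nu>) (u0n \<nu>)
                 (approx_v0 \<gamma> vm \<nu> vs (w \<nu>)) (approx_u0 \<gamma> vm um \<nu> us (w \<nu>)))
           \<longlongrightarrow> initial_energy \<gamma> vl ul vm um vp v0 u0) (at_right 0) \<and>
        (\<forall>\<nu>>0. NS_solution \<gamma> \<alpha> \<nu> (v0n \<nu>) (u0n \<nu>) (vn \<nu>) (un \<nu>)) \<and>
        (\<forall>\<phi>. test_fun T \<phi> \<longrightarrow>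
           ((\<lambda>\<nu>. LINT (t, x)|lborel_strip T. \<phi> (t, x) * vn \<nu> t x)
              \<longlongrightarrow> (LINT p|V. \<phi> p)) (at_right 0) \<and>
           ((\<lambda>\<nu>. LINT (t, x)|lborel_strip T. \<phi> (t, x) * un \<nu> t x)
              \<longlongrightarrow> (LINT (t, x)|lborel_strip T. \<phi> (t, x) * u t x)) (at_right 0))) \<and>
     (\<exists>ma vsing X.
        lebesgue_decomposition T V ma vsing \<and> bounded_variation_on {0<..<T} X \<and>
        stability_estimate T \<gamma> vl ul vm um vp (K T)
          (enn2real (initial_energy \<gamma> vl ul vm um vp v0 u0)) u ma vsing X)"

end

theory Submission
  imports Defs
begin

text \<open>
  An inviscid limit comes with the stability estimate, whose right-hand side
  \<open>C(T) (E + E\<^bsup>1/3\<^esup>)\<close> vanishes together with the initial energy \<open>E\<close>. Its left-hand side is a sum of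
  three non-negative terms, so each of them vanishes at almost every time, and each determines one
  component of the limit.

  \<^item> The velocity term is a squared \<open>L\<^sup>2\<close> distance, so the velocity is that of the composite wave.

  \<^item> The potential \<open>Q\<close> is strictly convex, so \<open>Q(v|w)\<close> vanishes only for \<open>v = w\<close>
    (\<open>Qrel_eq_0D\<close>). Hence the absolutely continuous part of the specific volume has the density of
    the composite wave.

  \<^item> The weight \<open>|Q'|\<close> on the singular part is evaluated at values in \<open>(0, vl]\<close>. There
    \<open>|Q'(v)| = v\<^bsup>-\<gamma>\<^esup>\<close> is at least \<open>vl\<^bsup>-\<gamma>\<^esup> > 0\<close> (\<open>abs_deriv_Qpot_Vbar_ge\<close>), whatever the shift of the
    shock is. A measure with vanishing weighted mass is therefore zero.

  These are statements about almost every time slice. Fubini's theorem turns them into statements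
  about the strip (\<open>AE_strip_eq_of_slices\<close>), once the composite wave is known to be Borel
  measurable; this is read off from closed formulas for the inverse of the characteristic speed and
  for the velocity on the rarefaction curve. Since the limit is thus expressed by the end states
  alone, any two inviscid limits of unperturbed data coincide.
\<close>

section \<open>The second characteristic speed and its inverse\<close>

lemma deriv_pres:
  assumes "0 < v"
  shows "deriv (pres \<gamma>) v = - \<gamma> * v powr (- \<gamma> - 1)"
proof -
  have "((\<lambda>v. v powr (- \<gamma>)) has_real_derivative - \<gamma> * v powr (- \<gamma> - 1)) (at v)"
    using assms by (auto intro!: derivative_eq_intros)
  then show ?thesis
    unfolding pres_def by (rule DERIV_imp_deriv)
qed

lemma lambda2_eq:
  assumes "0 < v"
  shows "lambda2 \<gamma> v = sqrt (\<gamma> * v powr (- \<gamma> - 1))"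
  using deriv_pres[OF assms, of \<gamma>] by (simp add: lambda2_def)

lemma lambda2_pos:
  assumes "1 < \<gamma>" "0 < v"
  shows "0 < lambda2 \<gamma> v"
  using assms by (simp add: lambda2_eq)

lemma lambda2_strict_antimono:
  assumes "1 < \<gamma>" "0 < v" "v < v'"
  shows "lambda2 \<gamma> v' < lambda2 \<gamma> v"
proof -
  have "v' powr (- \<gamma> - 1) < v powr (- \<gamma> - 1)"
    using assms by (intro powr_less_mono2_neg) auto
  then show ?thesis
    using assms by (simp add: lambda2_eq)
qed

lemma lambda2_inv_eq:
  assumes "1 < \<gamma>" "0 < w"
  shows "lambda2_inv \<gamma> w = (w\<^sup>2 / \<gamma>) powr (- 1 / (\<gamma> + 1))"
proof -
  let ?v = "(w\<^sup>2 / \<gamma>) powr (- 1 / (\<gamma> + 1))"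
  have pos: "0 < w\<^sup>2 / \<gamma>"
    using assms by simp
  have "(- 1 / (\<gamma> + 1)) * (- \<gamma> - 1) = 1"
    using assms by (simp add: field_simps)
  then have "?v powr (- \<gamma> - 1) = w\<^sup>2 / \<gamma>"
    using pos assms by (simp only: powr_powr) simp
  then have "lambda2 \<gamma> ?v = w"
    using assms by (simp add: lambda2_eq)
  moreover have "inj_on (lambda2 \<gamma>) {0<..}"
    using assms(1)
    by (intro linorder_inj_onI) (auto dest: lambda2_strict_antimono)
  ultimately show ?thesis
    unfolding lambda2_inv_def using assms by (intro inv_into_f_eq) auto
qed

text \<open>The speed decreases in the specific volume, so a lower bound on the speed is an upper bound on
  the volume.\<close>

lemma lambda2_inv_bounds:
  assumes "1 < \<gamma>" "0 < v" "lambda2 \<gamma> v \<le> w"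
  shows "0 < lambda2_inv \<gamma> w" "lambda2_inv \<gamma> w \<le> v"
proof -
  have w: "0 < w"
    using lambda2_pos[OF assms(1,2)] assms(3) by simp
  show "0 < lambda2_inv \<gamma> w"
    using assms w by (simp add: lambda2_inv_eq)
  have "lambda2_inv \<gamma> (lambda2 \<gamma> v) = v"
    unfolding lambda2_inv_def using assms(1,2)
    by (intro inv_into_f_f linorder_inj_onI) (auto dest: lambda2_strict_antimono)
  moreover have "lambda2_inv \<gamma> w \<le> lambda2_inv \<gamma> (lambda2 \<gamma> v)"
    using assms w lambda2_pos[OF assms(1,2)]
    by (auto simp: lambda2_inv_eq intro!: powr_mono2' divide_right_mono power_mono)
  ultimately show "lambda2_inv \<gamma> w \<le> v"
    by simp
qed

text \<open>Since \<open>\<lambda>\<^sub>2(s) = \<surd>\<gamma> s\<^bsup>-(\<gamma>+1)/2\<^esup>\<close> is an explicit power, the velocity on the rarefaction curve is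
  elementary. The closed form makes its Borel measurability in \<open>v\<close> evident.\<close>

lemma rarefaction_u_eq:
  assumes "1 < \<gamma>" "0 < vm" "0 < v"
  shows "rarefaction_u \<gamma> vm um v =
    um - 2 * sqrt \<gamma> / (1 - \<gamma>) * (v powr ((1 - \<gamma>) / 2) - vm powr ((1 - \<gamma>) / 2))"
proof -
  let ?F = "\<lambda>s. 2 * sqrt \<gamma> / (1 - \<gamma>) * s powr ((1 - \<gamma>) / 2)"
  have sub: "{min vm v..max vm v} \<subseteq> {0<..}"
    using assms by auto
  have lam: "lambda2 \<gamma> s = sqrt \<gamma> * s powr ((- \<gamma> - 1) / 2)" if "0 < s" for s
    using that by (simp add: lambda2_eq real_sqrt_mult powr_half_sqrt_powr)
  have "continuous_on {min vm v..max vm v} (\<lambda>s. sqrt \<gamma> * s powr ((- \<gamma> - 1) / 2))"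
    using sub by (intro continuous_intros) auto
  then have cont: "continuous_on {min vm v..max vm v} (lambda2 \<gamma>)"
    by (rule continuous_on_eq) (use lam sub in auto)
  have "(?F has_vector_derivative lambda2 \<gamma> s) (at s within {min vm v..max vm v})"
    if "min vm v \<le> s" "s \<le> max vm v" for s
  proof -
    have s: "0 < s"
      using that assms by auto
    have "(?F has_real_derivative 2 * sqrt \<gamma> / (1 - \<gamma>) * ((1 - \<gamma>) / 2 * s powr ((1 - \<gamma>) / 2 - 1))) (at s)"
      by (intro DERIV_cmult has_real_derivative_powr s)
    moreover have "2 * sqrt \<gamma> / (1 - \<gamma>) * ((1 - \<gamma>) / 2 * s powr ((1 - \<gamma>) / 2 - 1)) = lambda2 \<gamma> s"
    proof -
      have "(1 - \<gamma>) / 2 - 1 = (- \<gamma> - 1) / 2"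
        by (simp add: field_simps)
      then have "s powr ((1 - \<gamma>) / 2 - 1) = s powr ((- \<gamma> - 1) / 2)"
        by (rule arg_cong)
      then show ?thesis
        using assms(1) lam[OF s] by simp
    qed
    ultimately show ?thesis
      by (simp add: has_real_derivative_iff_has_vector_derivative has_vector_derivative_at_within)
  qed
  then have "(LBINT s=ereal vm..ereal v. lambda2 \<gamma> s) = ?F v - ?F vm"
    by (intro interval_integral_FTC_finite cont)
  then show ?thesis
    by (simp add: rarefaction_u_def right_diff_distrib)
qed

section \<open>Strict convexity of the potential energy\<close>

lemma deriv_Qpot:
  assumes "1 < \<gamma>" "0 < v"
  shows "(Qpot \<gamma> has_real_derivative - (v powr (- \<gamma>))) (at v)"
    and "deriv (Qpot \<gamma>) v = - (v powr (- \<gamma>))"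
proof -
  have "((\<lambda>v. v powr (1 - \<gamma>) / (\<gamma> - 1)) has_real_derivative
      (1 - \<gamma>) * v powr (1 - \<gamma> - 1) / (\<gamma> - 1)) (at v)"
    by (intro DERIV_cdivide has_real_derivative_powr assms)
  moreover have "(1 - \<gamma>) * v powr (1 - \<gamma> - 1) / (\<gamma> - 1) = - (v powr (- \<gamma>))"
    using assms by (simp add: field_simps)
  ultimately show "(Qpot \<gamma> has_real_derivative - (v powr (- \<gamma>))) (at v)"
    unfolding Qpot_def[abs_def] by simp
  then show "deriv (Qpot \<gamma>) v = - (v powr (- \<gamma>))"
    by (rule DERIV_imp_deriv)
qed

text \<open>Strict because \<open>Q'(v) = -v\<^bsup>-\<gamma>\<^esup>\<close> is strictly increasing: the mean value theorem compares the
  slope of the chord with that of the tangent.\<close>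

lemma Qpot_above_tangent:
  assumes "1 < \<gamma>" "0 < v" "0 < w" "v \<noteq> w"
  shows "Qpot \<gamma> w + deriv (Qpot \<gamma>) w * (v - w) < Qpot \<gamma> v"
proof (cases "v < w")
  case True
  obtain z where z: "v < z" "z < w" "Qpot \<gamma> w - Qpot \<gamma> v = (w - v) * - (z powr (- \<gamma>))"
    using MVT2[OF True, of "Qpot \<gamma>" "\<lambda>z. - (z powr (- \<gamma>))"] deriv_Qpot(1) assms by auto
  have "w powr (- \<gamma>) < z powr (- \<gamma>)"
    using assms z by (intro powr_less_mono2_neg) auto
  then have "(w - v) * w powr (- \<gamma>) < (w - v) * z powr (- \<gamma>)"
    using True by simp
  then show ?thesis
    using z(3) assms by (simp add: deriv_Qpot algebra_simps)
next
  case False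
  with assms have "w < v"
    by simp
  then obtain z where z: "w < z" "z < v" "Qpot \<gamma> v - Qpot \<gamma> w = (v - w) * - (z powr (- \<gamma>))"
    using MVT2[of w v "Qpot \<gamma>" "\<lambda>z. - (z powr (- \<gamma>))"] deriv_Qpot(1) assms by auto
  have "z powr (- \<gamma>) < w powr (- \<gamma>)"
    using assms z by (intro powr_less_mono2_neg) auto
  then have "(v - w) * z powr (- \<gamma>) < (v - w) * w powr (- \<gamma>)"
    using \<open>w < v\<close> by simp
  then show ?thesis
    using z(3) assms by (simp add: deriv_Qpot algebra_simps)
qed

text \<open>The relative potential separates points. The case \<open>v \<le> 0\<close> is excluded by the value
  \<open>\<infinity>\<close> there.\<close>

lemma Qrel_eq_0D:
  assumes "1 < \<gamma>" "0 < w" "Qrel \<gamma> v w = 0"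
  shows "v = w"
proof -
  have v: "0 < v"
    using assms(3) by (auto simp: Qrel_def split: if_splits)
  with assms(3) have "Qpot \<gamma> v \<le> Qpot \<gamma> w + deriv (Qpot \<gamma>) w * (v - w)"
    by (simp add: Qrel_def ennreal_eq_0_iff)
  with Qpot_above_tangent[OF assms(1) v assms(2)] show ?thesis
    by fastforce
qed

lemma borel_measurable_Qrel:
  assumes "1 < \<gamma>" "f \<in> borel_measurable M" "g \<in> borel_measurable M" "\<And>x. 0 < g x"
  shows "(\<lambda>x. Qrel \<gamma> (f x) (g x)) \<in> borel_measurable M"
proof -
  have [measurable]: "f \<in> borel_measurable M" "g \<in> borel_measurable M"
    by fact+
  have "(\<lambda>x. Qrel \<gamma> (f x) (g x)) = (\<lambda>x. if 0 < f x
      then ennreal (f x powr (1 - \<gamma>) / (\<gamma> - 1) - g x powr (1 - \<gamma>) / (\<gamma> - 1)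
        - - (g x powr (- \<gamma>)) * (f x - g x)) else \<infinity>)"
    using assms by (auto simp: fun_eq_iff Qrel_def Qpot_def[of \<gamma>] deriv_Qpot(2))
  then show ?thesis
    by simp
qed

section \<open>Bounds and measurability of the composite wave\<close>

text \<open>Because the speeds are ordered, the middle branch of \<open>rarefaction_w\<close> is reached only for
  \<open>t > 0\<close>; this makes the bound valid at all times.\<close>

lemma rarefaction_w_bounds:
  assumes "1 < \<gamma>" "0 < vp" "vp \<le> vm"
  shows "lambda2 \<gamma> vm \<le> rarefaction_w \<gamma> vm vp t x"
proof -
  have le: "lambda2 \<gamma> vm \<le> lambda2 \<gamma> vp"
    using lambda2_strict_antimono[of \<gamma> vp vm] assms by (cases "vp = vm") auto
  have "lambda2 \<gamma> vm \<le> x / t" if *: "lambda2 \<gamma> vm * t < x" "x < lambda2 \<gamma> vp * t"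
  proof -
    have "0 < t"
    proof (rule ccontr)
      assume "\<not> 0 < t"
      then have "lambda2 \<gamma> vp * t \<le> lambda2 \<gamma> vm * t"
        using le by (intro mult_right_mono_neg) auto
      with * show False
        by simp
    qed
    with * show ?thesis
      by (simp add: field_simps)
  qed
  with le show ?thesis
    by (auto simp: rarefaction_w_def)
qed

lemma rarefaction_wave_v_bounds:
  assumes "1 < \<gamma>" "0 < vp" "vp \<le> vm"
  shows "0 < rarefaction_wave_v \<gamma> vm vp t x" "rarefaction_wave_v \<gamma> vm vp t x \<le> vm"
  unfolding rarefaction_wave_v_def
  using lambda2_inv_bounds[of \<gamma> vm] rarefaction_w_bounds[OF assms] assms by auto

lemma borel_measurable_rarefaction_wave_v:
  assumes "1 < \<gamma>" "0 < vp" "vp \<le> vm"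
  shows "case_prod (rarefaction_wave_v \<gamma> vm vp) \<in> borel_measurable borel"
proof -
  have "0 < rarefaction_w \<gamma> vm vp t x" for t x
    using lambda2_pos[of \<gamma> vm] rarefaction_w_bounds[OF assms, of t x] assms by auto
  then have "case_prod (rarefaction_wave_v \<gamma> vm vp) = (\<lambda>p. ((if snd p \<le> lambda2 \<gamma> vm * fst p
        then lambda2 \<gamma> vm else if snd p < lambda2 \<gamma> vp * fst p then snd p / fst p
        else lambda2 \<gamma> vp)\<^sup>2 / \<gamma>) powr (- 1 / (\<gamma> + 1)))"
    using assms(1)
    by (auto simp: fun_eq_iff rarefaction_wave_v_def lambda2_inv_eq) (simp_all add: rarefaction_w_def)
  then show ?thesis
    by (simp add: borel_prod[symmetric])
qed

lemma composite_v_pos: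
  assumes "1 < \<gamma>" "0 < vp" "vp \<le> vm" "vm < vl"
  shows "0 < composite_v \<gamma> vl vm vp t x"
  using rarefaction_wave_v_bounds(1)[OF assms(1-3), of t x] assms(4)
  by (simp add: composite_v_def shock_wave_def)

lemma borel_measurable_shock_wave:
  "case_prod (shock_wave \<sigma> l r) \<in> borel_measurable borel"
  unfolding shock_wave_def[abs_def] case_prod_beta borel_prod[symmetric] by measurable

lemma borel_measurable_composite_v:
  assumes "1 < \<gamma>" "0 < vp" "vp \<le> vm"
  shows "case_prod (composite_v \<gamma> vl vm vp) \<in> borel_measurable borel"
  using borel_measurable_rarefaction_wave_v[OF assms]
    borel_measurable_shock_wave[of "sigma1 \<gamma> vl vm" vl vm]
  unfolding composite_v_def[abs_def] case_prod_beta by measurable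

lemma borel_measurable_composite_u:
  assumes "1 < \<gamma>" "0 < vp" "vp \<le> vm"
  shows "case_prod (composite_u \<gamma> vl ul vm um vp) \<in> borel_measurable borel"
proof -
  have "case_prod (composite_u \<gamma> vl ul vm um vp) = (\<lambda>p.
      case_prod (shock_wave (sigma1 \<gamma> vl vm) ul um) p
      + (um - 2 * sqrt \<gamma> / (1 - \<gamma>) * (case_prod (rarefaction_wave_v \<gamma> vm vp) p powr ((1 - \<gamma>) / 2)
            - vm powr ((1 - \<gamma>) / 2))) - um)"
    using assms rarefaction_wave_v_bounds(1)[OF assms]
    by (auto simp: fun_eq_iff composite_u_def rarefaction_wave_u_def rarefaction_u_eq)
  then show ?thesis
    using borel_measurable_rarefaction_wave_v[OF assms]
      borel_measurable_shock_wave[of "sigma1 \<gamma> vl vm" ul um] by simp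
qed

section \<open>From time slices to the strip\<close>

lemma strip_sets: "strip T \<in> sets lborel"
  by (simp add: borel_open open_Times)

lemma borel_measurable_slice:
  fixes f :: "real \<Rightarrow> real \<Rightarrow> real"
  assumes "case_prod f \<in> borel_measurable (lborel_strip T)" "t \<in> {0<..<T}"
  shows "f t \<in> borel_measurable lborel"
proof -
  have "Pair t \<in> lborel \<rightarrow>\<^sub>M lborel_strip T"
    using assms(2) by (intro measurable_restrict_space2) (auto simp: borel_prod[symmetric])
  from measurable_compose[OF this assms(1)] show ?thesis
    by simp
qed

text \<open>Fubini's theorem for null sets. It needs the exceptional set to be measurable in the plane,
  which is why \<open>f\<close> and \<open>g\<close> are required to be jointly measurable.\<close>

lemma AE_strip_eq_of_slices:
  fixes f g :: "real \<Rightarrow> real \<Rightarrow> real"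
  assumes f: "case_prod f \<in> borel_measurable (lborel_strip T)"
    and g: "case_prod g \<in> borel_measurable (lborel_strip T)"
    and eq: "AE t in lborel. t \<in> {0<..<T} \<longrightarrow> (AE x in lborel. f t x = g t x)"
  shows "AE (t, x) in lborel_strip T. f t x = g t x"
proof -
  let ?E = "{p \<in> space (lborel_strip T). case_prod f p = case_prod g p}"
  have "?E \<in> sets (lborel_strip T)"
    using f g by measurable
  then have "?E \<in> sets lborel"
    using strip_sets by (simp add: sets_restrict_space_iff)
  then have "(- strip T) \<union> ?E \<in> sets lborel"
    using sets.compl_sets[OF strip_sets[of T]] by (intro sets.Un) (simp_all add: Compl_eq_Diff_UNIV)
  also have "(- strip T) \<union> ?E = {p. p \<in> strip T \<longrightarrow> case_prod f p = case_prod g p}"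
    by (auto simp: space_restrict_space)
  finally have meas: "{p \<in> space (lborel \<Otimes>\<^sub>M lborel). p \<in> strip T \<longrightarrow> case_prod f p = case_prod g p}
      \<in> sets (lborel \<Otimes>\<^sub>M (lborel :: real measure))"
    unfolding lborel_prod by simp
  have "AE p in lborel \<Otimes>\<^sub>M lborel. p \<in> strip T \<longrightarrow> case_prod f p = case_prod g p"
    by (rule lborel_pair.AE_pair_measure[OF meas]) (use eq in \<open>auto elim!: eventually_mono\<close>)
  then have "AE p in lborel. p \<in> strip T \<longrightarrow> case_prod f p = case_prod g p"
    unfolding lborel_prod .
  then show ?thesis
    using strip_sets[of T] by (simp add: AE_restrict_space_iff case_prod_beta)
qed

section \<open>Inviscid limits of unperturbed data\<close>

text \<open>Both branches of \<open>Vbar\<close> take values in \<open>(0, vl]\<close>, where \<open>|Q'|\<close> decreases. The bound is uniform,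
  so it also bounds the weighted mass of a time slice from below by a multiple of its mass.\<close>

lemma abs_deriv_Qpot_Vbar_ge:
  assumes "1 < \<gamma>" "0 < vp" "vp \<le> vm" "vm < vl"
  shows "vl powr (- \<gamma>) \<le> \<bar>deriv (Qpot \<gamma>) (Vbar T \<gamma> vl vm vp X t x)\<bar>"
proof -
  have "0 < Vbar T \<gamma> vl vm vp X t x" "Vbar T \<gamma> vl vm vp X t x \<le> vl"
    using rarefaction_wave_v_bounds[OF assms(1-3), of t x] assms by (auto simp: Vbar_def)
  then show ?thesis
    using assms(1) by (auto simp: deriv_Qpot(2) intro!: powr_mono2')
qed

text \<open>The limit is determined as a measure: its singular part is zero, so the specific volume is
  absolutely continuous with the density of the composite wave.\<close>

lemma inviscid_limit_zero_energy:
  assumes "1 < \<gamma>" "0 < vp" "vp \<le> vm" "vm < vl"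
    and E: "initial_energy \<gamma> vl ul vm um vp v0 u0 = 0"
    and lim: "inviscid_limit \<gamma> \<alpha> vl ul vm um vp K T v0 u0 V u"
  shows "AE (t, x) in lborel_strip T. u t x = composite_u \<gamma> vl ul vm um vp t x"
    and "V = density (lborel_strip T) (\<lambda>(t, x). ennreal (composite_v \<gamma> vl vm vp t x))"
proof -
  let ?cu = "composite_u \<gamma> vl ul vm um vp" and ?cv = "composite_v \<gamma> vl vm vp"
  from lim obtain ma vsing X where
      V_sets: "sets V = sets (lborel_strip T)"
    and u: "case_prod u \<in> borel_measurable (lborel_strip T)"
    and split: "splits_as T V ma vsing"
    and stab: "stability_estimate T \<gamma> vl ul vm um vp (K T)
      (enn2real (initial_energy \<gamma> vl ul vm um vp v0 u0)) u ma vsing X"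
    unfolding inviscid_limit_def radon_on_strip_def in_Linf_L2loc_def lebesgue_decomposition_def
    by (elim conjE exE) (rule that)
  from split have ma: "case_prod ma \<in> borel_measurable (lborel_strip T)"
    and kernel: "time_kernel T vsing"
    and V_eq: "\<And>A. A \<in> sets (lborel_strip T) \<Longrightarrow>
      emeasure V A = (\<integral>\<^sup>+(t, x)\<in>A. ennreal (ma t x) \<partial>lborel_strip T) + slice_measure T vsing A"
    unfolding splits_as_def by blast+
  have cu: "case_prod ?cu \<in> borel_measurable (lborel_strip T)"
    using borel_measurable_composite_u[OF assms(1-3)] by (intro measurable_restrict_space1) simp
  have cv: "case_prod ?cv \<in> borel_measurable (lborel_strip T)"
    using borel_measurable_composite_v[OF assms(1-3)] by (intro measurable_restrict_space1) simp
  \<comment> \<open>\<open>E = 0\<close> makes the bound zero, as \<open>0 powr (1 / 3) = 0\<close>, and the three terms are non-negative.\<close>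
  have zero: "AE t in lborel. t \<in> {0<..<T} \<longrightarrow>
      (\<integral>\<^sup>+x. ennreal (\<bar>u t x - ?cu t x\<bar>\<^sup>2 / 2) \<partial>lborel) = 0 \<and>
      (\<integral>\<^sup>+x. Qrel \<gamma> (ma t x) (?cv t x) \<partial>lborel) = 0 \<and>
      (\<integral>\<^sup>+x. ennreal \<bar>deriv (Qpot \<gamma>) (Vbar T \<gamma> vl vm vp X t x)\<bar> \<partial>vsing t) = 0"
    using stab unfolding stability_estimate_def E by simp

  have "AE t in lborel. t \<in> {0<..<T} \<longrightarrow> (AE x in lborel. u t x = ?cu t x)"
    using zero
  proof eventually_elim
    case (elim t)
    show ?case
    proof
      assume t: "t \<in> {0<..<T}"
      have "(\<lambda>x. ennreal (\<bar>u t x - ?cu t x\<bar>\<^sup>2 / 2)) \<in> borel_measurable lborel"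
        using borel_measurable_slice[OF u t] borel_measurable_slice[OF cu t] by measurable
      with elim t have "AE x in lborel. ennreal (\<bar>u t x - ?cu t x\<bar>\<^sup>2 / 2) = 0"
        by (simp add: nn_integral_0_iff_AE)
      then show "AE x in lborel. u t x = ?cu t x"
        by eventually_elim (simp add: ennreal_eq_0_iff)
    qed
  qed
  then show "AE (t, x) in lborel_strip T. u t x = ?cu t x"
    by (rule AE_strip_eq_of_slices[OF u cu])

  have "AE t in lborel. t \<in> {0<..<T} \<longrightarrow> (AE x in lborel. ma t x = ?cv t x)"
    using zero
  proof eventually_elim
    case (elim t)
    show ?case
    proof
      assume t: "t \<in> {0<..<T}"
      have "(\<lambda>x. Qrel \<gamma> (ma t x) (?cv t x)) \<in> borel_measurable lborel"
        using assms by (intro borel_measurable_Qrel borel_measurable_slice[OF ma t]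
            borel_measurable_slice[OF cv t] composite_v_pos)
      with elim t have "AE x in lborel. Qrel \<gamma> (ma t x) (?cv t x) = 0"
        by (simp add: nn_integral_0_iff_AE)
      then show "AE x in lborel. ma t x = ?cv t x"
        by eventually_elim (use assms in \<open>auto intro: Qrel_eq_0D composite_v_pos\<close>)
    qed
  qed
  then have ma_eq: "AE (t, x) in lborel_strip T. ma t x = ?cv t x"
    by (rule AE_strip_eq_of_slices[OF ma cv])

  have vsing_0: "AE t in lborel. t \<in> {0<..<T} \<longrightarrow> emeasure (vsing t) UNIV = 0"
    using zero
  proof eventually_elim
    case (elim t)
    show ?case
    proof
      assume t: "t \<in> {0<..<T}"
      have space: "space (vsing t) = UNIV"
        using kernel t sets_eq_imp_space_eq[of "vsing t" borel] by (simp add: time_kernel_def)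
      have "(\<integral>\<^sup>+x. ennreal (vl powr (- \<gamma>)) \<partial>vsing t)
          \<le> (\<integral>\<^sup>+x. ennreal \<bar>deriv (Qpot \<gamma>) (Vbar T \<gamma> vl vm vp X t x)\<bar> \<partial>vsing t)"
        by (intro nn_integral_mono ennreal_leI abs_deriv_Qpot_Vbar_ge assms)
      also have "\<dots> = 0"
        using elim t by simp
      finally show "emeasure (vsing t) UNIV = 0"
        using assms by (simp add: space ennreal_eq_0_iff)
    qed
  qed
  have slice_0: "slice_measure T vsing A = 0" for A
  proof -
    have "AE t in lborel. emeasure (vsing t) {x. (t, x) \<in> A} * indicator {0<..<T} t = 0"
      using vsing_0
    proof eventually_elim
      case (elim t)
      have "emeasure (vsing t) {x. (t, x) \<in> A} \<le> emeasure (vsing t) UNIV" if "t \<in> {0<..<T}"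
        using kernel that by (intro emeasure_mono) (auto simp: time_kernel_def)
      with elim show ?case
        by (auto simp: indicator_def)
    qed
    then have "slice_measure T vsing A = (\<integral>\<^sup>+t. 0 \<partial>(lborel :: real measure))"
      unfolding slice_measure_def by (rule nn_integral_cong_AE)
    then show ?thesis
      by simp
  qed

  show "V = density (lborel_strip T) (\<lambda>(t, x). ennreal (?cv t x))"
  proof (rule measure_eqI)
    show "sets V = sets (density (lborel_strip T) (\<lambda>(t, x). ennreal (?cv t x)))"
      using V_sets by simp
    fix A assume "A \<in> sets V"
    then have A: "A \<in> sets (lborel_strip T)"
      by (simp add: V_sets)
    have "(\<lambda>p. ennreal (case_prod ?cv p)) \<in> borel_measurable (lborel_strip T)"
      using cv by measurable
    then have dens: "(\<lambda>(t, x). ennreal (?cv t x)) \<in> borel_measurable (lborel_strip T)"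
      by (simp add: case_prod_beta)
    have "emeasure V A = (\<integral>\<^sup>+(t, x)\<in>A. ennreal (ma t x) \<partial>lborel_strip T)"
      using V_eq[OF A] slice_0 by simp
    also have "\<dots> = (\<integral>\<^sup>+(t, x)\<in>A. ennreal (?cv t x) \<partial>lborel_strip T)"
      by (rule nn_integral_cong_AE) (use ma_eq in eventually_elim, auto)
    also have "\<dots> = emeasure (density (lborel_strip T) (\<lambda>(t, x). ennreal (?cv t x))) A"
      by (rule emeasure_density[OF dens A, symmetric])
    finally show "emeasure V A = emeasure (density (lborel_strip T) (\<lambda>(t, x). ennreal (?cv t x))) A" .
  qed
qed

theorem corollary1p2:
  fixes \<gamma> \<alpha> vl ul vm um vp up T :: real
    and C K :: "real \<Rightarrow> real"
    and v0 u0 :: "real \<Rightarrow> real"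
    and V :: "(real \<times> real) measure"
    and u :: "real \<Rightarrow> real \<Rightarrow> real"
  assumes "1 < \<gamma>" and "0 < \<alpha>" and "\<alpha> \<le> \<gamma>" and "\<gamma> \<le> \<alpha> + 1"
    and "0 < vl"
    and "one_shock \<gamma> vl ul vm um"
    and "two_rarefaction \<gamma> vm um vp up"
    and "\<forall>v>0. 0 < C v"
    and "\<bar>pres \<gamma> vm - pres \<gamma> vp\<bar> \<le> C vl * \<bar>pres \<gamma> vl - pres \<gamma> vm\<bar>"
    and "0 < T"
    and "\<forall>s>0. 0 < K s"
    and "initial_energy \<gamma> vl ul vm um vp v0 u0 = 0"
    and "inviscid_limit \<gamma> \<alpha> vl ul vm um vp K T v0 u0 V u"
  shows "(AE (t, x) in lborel_strip T. u t x = composite_u \<gamma> vl ul vm um vp t x) \<and>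
    V = density (lborel_strip T) (\<lambda>(t, x). ennreal (composite_v \<gamma> vl vm vp t x)) \<and>
    (\<forall>v0' u0' V' u'.
       initial_energy \<gamma> vl ul vm um vp v0' u0' = 0 \<and>
       inviscid_limit \<gamma> \<alpha> vl ul vm um vp K T v0' u0' V' u' \<longrightarrow>
       V' = V \<and> (AE (t, x) in lborel_strip T. u' t x = u t x))"
proof -
  have states: "0 < vp" "vp \<le> vm" "vm < vl"
    using \<open>one_shock \<gamma> vl ul vm um\<close> \<open>two_rarefaction \<gamma> vm um vp up\<close>
    by (auto simp: one_shock_def two_rarefaction_def)
  note limit = inviscid_limit_zero_energy[OF \<open>1 < \<gamma>\<close> states]
  note this_limit = limit[OF \<open>initial_energy \<gamma> vl ul vm um vp v0 u0 = 0\<close>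
      \<open>inviscid_limit \<gamma> \<alpha> vl ul vm um vp K T v0 u0 V u\<close>]
  show ?thesis
  proof (intro conjI allI impI, goal_cases)
    case 1
    show ?case by (rule this_limit(1))
  next
    case 2
    show ?case by (rule this_limit(2))
  next
    case (3 v0' u0' V' u')
    then show ?case
      using limit(2) this_limit(2) by blast
  next
    case (4 v0' u0' V' u')
    then have "AE (t, x) in lborel_strip T. u' t x = composite_u \<gamma> vl ul vm um vp t x"
      using limit(1) by blast
    with this_limit(1) show ?case
      by eventually_elim auto
  qed
qed

end
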